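(* Let $Q=(q_{ij})$ be a real symmetric $n\times n$ matrix with zero diagonal, $c\in\mathbb{R}^n$, $R_i=\{j:q_{ij}\neq0\}$. Let $\overline{GW}$ be the linear program in variables $x_i$ and $y_{ij}$ ($j\in R_i$): maximize $\sum_{i}\sum_{j\in R_i}q_{ij}y_{ij}+\sum_i c_ix_i$ subject to $x_i+x_j-y_{ij}\le1$, $y_{ij}\le x_i$, $y_{ji}\le x_i$ for all $j\in R_i$, $i=1,\dots,n$; $0\le x_i\le 1$; $y_{ij}\ge0$. Let $\overline{FT}$ be the linear program with the same objective subject to $x_i+x_j-y_{ij}\le1$, $y_{ij}\le x_i$, $y_{ij}\le y_{ji}$ for all $j\in R_i$, $i=1,\dots,n$; $0\le x_i\le1$; $y_{ij}\ge0$. Then the optimal objective values of $\overline{GW}$ and $\overline{FT}$ are equal.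
   Context: $\overline{GW}$ and $\overline{FT}$ are the linear programming relaxations (binary constraints $x_i\in\{0,1\}$ replaced by $0\le x_i\le1$) of the standard (Glover–Woolsey) linearization GW and the Fortet linearization FT of the QUBO problem: maximize $\sum_{i}\sum_{j\in R_i}q_{ij}x_ix_j+\sum_i c_ix_i$ over $x\in\{0,1\}^n$. *)

theory Defs
  imports "HOL-Analysis.Analysis" "HOL-Library.FuncSet"
begin

definition nz_row :: "real^'n^'n \<Rightarrow> 'n \<Rightarrow> 'n set"
  where "nz_row Q i = {j. Q $ i $ j \<noteq> 0}"

text \<open>The LP has a variable \<open>y (i, j)\<close> only for pairs with \<open>j \<in> nz_row Q i\<close>. In the feasible
  sets below, \<open>y\<close> is therefore required to be extensional on this index set, so that points
  of the LP are represented uniquely.\<close>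

definition quad_pairs :: "real^'n^'n \<Rightarrow> ('n \<times> 'n) set"
  where "quad_pairs Q = (SIGMA i:UNIV. nz_row Q i)"

definition lin_objective ::
    "real^'n^'n \<Rightarrow> real^'n \<Rightarrow> (real^'n) \<times> ('n \<times> 'n \<Rightarrow> real) \<Rightarrow> real"
  where "lin_objective Q c = (\<lambda>(x, y).
    (\<Sum>i\<in>UNIV. \<Sum>j\<in>nz_row Q i. Q $ i $ j * y (i, j)) + (\<Sum>i\<in>UNIV. c $ i * x $ i))"

definition GW_relax_feasible :: "real^'n^'n \<Rightarrow> ((real^'n) \<times> ('n \<times> 'n \<Rightarrow> real)) set"
  where "GW_relax_feasible Q = {(x, y).
    y \<in> extensional (quad_pairs Q) \<and>
    (\<forall>i. \<forall>j\<in>nz_row Q i.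
      x $ i + x $ j - y (i, j) \<le> 1 \<and> y (i, j) \<le> x $ i \<and> y (j, i) \<le> x $ i) \<and>
    (\<forall>i. 0 \<le> x $ i \<and> x $ i \<le> 1) \<and>
    (\<forall>i. \<forall>j\<in>nz_row Q i. 0 \<le> y (i, j))}"

definition FT_relax_feasible :: "real^'n^'n \<Rightarrow> ((real^'n) \<times> ('n \<times> 'n \<Rightarrow> real)) set"
  where "FT_relax_feasible Q = {(x, y).
    y \<in> extensional (quad_pairs Q) \<and>
    (\<forall>i. \<forall>j\<in>nz_row Q i.
      x $ i + x $ j - y (i, j) \<le> 1 \<and> y (i, j) \<le> x $ i \<and> y (i, j) \<le> y (j, i)) \<and>
    (\<forall>i. 0 \<le> x $ i \<and> x $ i \<le> 1) \<and>
    (\<forall>i. \<forall>j\<in>nz_row Q i. 0 \<le> y (i, j))}"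

definition is_max_value :: "('a \<Rightarrow> real) \<Rightarrow> 'a set \<Rightarrow> real \<Rightarrow> bool"
  where "is_max_value f F v \<longleftrightarrow> (\<exists>p\<in>F. f p = v) \<and> (\<forall>p\<in>F. f p \<le> v)"

end

theory Submission
  imports Defs
begin

text \<open>For fixed \<open>x\<close>, the constraints of either program confine \<open>y (i, j)\<close> to the interval
  from \<open>max 0 (x $ i + x $ j - 1)\<close> to \<open>min (x $ i) (x $ j)\<close>. Taking in each coordinate the end of
  this interval that the sign of \<open>Q $ i $ j\<close> favours gives a best \<open>y\<close> for the weaker program GW.
  As \<open>Q\<close> is symmetric, so is this \<open>y\<close>, and it is therefore feasible for FT too. Both programs thus
  amount to maximizing the same continuous function of \<open>x\<close> over the unit cube.\<close>

text \<open>On \<open>quad_pairs Q\<close> no entry of \<open>Q\<close> vanishes, so the else branch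
  is the negative case. \<open>restrict\<close> supplies the extensionality that both feasible sets
  demand.\<close>

definition best_y :: "real^'n^'n \<Rightarrow> real^'n \<Rightarrow> 'n \<times> 'n \<Rightarrow> real"
  where "best_y Q x = restrict
    (\<lambda>(i, j). if Q $ i $ j > 0 then min (x $ i) (x $ j) else max 0 (x $ i + x $ j - 1))
    (quad_pairs Q)"

lemma mem_quad_pairs [simp]: "(i, j) \<in> quad_pairs Q \<longleftrightarrow> Q $ i $ j \<noteq> 0"
  by (simp add: quad_pairs_def nz_row_def)

lemma symmetric_nth:
  assumes "transpose Q = Q"
  shows "Q $ i $ j = Q $ j $ i"
  by (metis assms transpose_def vec_lambda_beta)

text \<open>Only \<open>y (j, i) \<le> x $ i\<close> is new; it follows by chaining two FT
  constraints through \<open>y (i, j)\<close>.\<close>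

lemma FT_relax_feasible_subset_GW:
  assumes "transpose Q = Q"
  shows "FT_relax_feasible Q \<subseteq> GW_relax_feasible Q"
proof
  fix p assume "p \<in> FT_relax_feasible Q"
  then obtain x y where p: "p = (x, y)" and xy: "(x, y) \<in> FT_relax_feasible Q"
    by (cases p) auto
  have "y (j, i) \<le> x $ i" if "j \<in> nz_row Q i" for i j
  proof -
    have "i \<in> nz_row Q j"
      using that symmetric_nth[OF assms] by (simp add: nz_row_def)
    then have "y (j, i) \<le> y (i, j)"
      using xy by (auto simp: FT_relax_feasible_def)
    also have "\<dots> \<le> x $ i"
      using xy that by (auto simp: FT_relax_feasible_def)
    finally show ?thesis .
  qed
  then show "p \<in> GW_relax_feasible Q"
    using xy by (auto simp: p FT_relax_feasible_def GW_relax_feasible_def)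
qed

lemma best_y_FT_feasible:
  assumes "transpose Q = Q" and "\<And>i. 0 \<le> x $ i \<and> x $ i \<le> 1"
  shows "(x, best_y Q x) \<in> FT_relax_feasible Q"
proof -
  \<comment> \<open>By symmetry of \<open>Q\<close> this is an equality.\<close>
  have "best_y Q x (i, j) \<le> best_y Q x (j, i)" if "Q $ i $ j \<noteq> 0" for i j
    using that symmetric_nth[OF assms(1), of i j] by (simp add: best_y_def min.commute add.commute)
  moreover have "x $ i + x $ j - best_y Q x (i, j) \<le> 1 \<and> best_y Q x (i, j) \<le> x $ i
      \<and> 0 \<le> best_y Q x (i, j)" if "Q $ i $ j \<noteq> 0" for i j
    using that assms(2)[of i] assms(2)[of j] by (auto simp: best_y_def)
  moreover have "best_y Q x \<in> extensional (quad_pairs Q)"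
    by (simp add: best_y_def)
  ultimately show ?thesis
    using assms(2) by (auto simp: FT_relax_feasible_def nz_row_def)
qed

lemma lin_objective_le_best_y:
  assumes "transpose Q = Q" and "(x, y) \<in> GW_relax_feasible Q"
  shows "lin_objective Q c (x, y) \<le> lin_objective Q c (x, best_y Q x)"
proof -
  have "Q $ i $ j * y (i, j) \<le> Q $ i $ j * best_y Q x (i, j)" if "j \<in> nz_row Q i" for i j
  proof -
    \<comment> \<open>The upper bound \<open>x $ j\<close> is the third GW constraint of the swapped
      pair, available because \<open>Q\<close> has symmetric support.\<close>
    have "i \<in> nz_row Q j"
      using that symmetric_nth[OF assms(1)] by (simp add: nz_row_def)
    then have "y (i, j) \<le> x $ j"
      using assms(2) by (auto simp: GW_relax_feasible_def)
    moreover have "y (i, j) \<le> x $ i" "x $ i + x $ j - y (i, j) \<le> 1" "0 \<le> y (i, j)"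
      using assms(2) that by (auto simp: GW_relax_feasible_def)
    ultimately show ?thesis
      using that by (auto simp: best_y_def nz_row_def intro!: mult_left_mono mult_left_mono_neg)
  qed
  then show ?thesis
    by (auto simp: lin_objective_def intro!: sum_mono)
qed

text \<open>The branch in \<open>best_y\<close> depends on \<open>Q\<close> alone, so each entry is
  a fixed min or max of continuous functions of \<open>x\<close>.\<close>

lemma continuous_on_best_y_value:
  "continuous_on S (\<lambda>x. lin_objective Q c (x, best_y Q x))"
proof -
  have "continuous_on S (\<lambda>x. best_y Q x (i, j))" if "j \<in> nz_row Q i" for i j
    using that by (cases "Q $ i $ j > 0")
      (auto simp: best_y_def nz_row_def intro!: continuous_intros)
  then show ?thesis
    unfolding lin_objective_def by (auto intro!: continuous_intros)
qed

theorem theorem21: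
  fixes Q :: "real^'n^'n" and c :: "real^'n"
  assumes symmetric: "transpose Q = Q"
    and zero_diagonal: "\<forall>i. Q $ i $ i = 0"
  shows "\<exists>v. is_max_value (lin_objective Q c) (GW_relax_feasible Q) v \<and>
             is_max_value (lin_objective Q c) (FT_relax_feasible Q) v"
proof -
  let ?g = "\<lambda>x. lin_objective Q c (x, best_y Q x)"
  have cube: "x \<in> cbox 0 1 \<longleftrightarrow> (\<forall>i. 0 \<le> x $ i \<and> x $ i \<le> 1)" for x :: "real^'n"
    by (simp add: mem_box_cart)
  have "cbox 0 1 \<noteq> ({} :: (real^'n) set)"
    using cube[of 0] by auto
  then obtain x0 :: "real^'n" where x0: "x0 \<in> cbox 0 1" "\<forall>x\<in>cbox 0 1. ?g x \<le> ?g x0"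
    using continuous_attains_sup[OF compact_cbox _ continuous_on_best_y_value] by metis
  \<comment> \<open>One point and one bound serve both programs: the point lies in the smaller
    feasible set, and the bound \<open>le\<close> holds on the larger one.\<close>
  have FT: "(x0, best_y Q x0) \<in> FT_relax_feasible Q"
    using best_y_FT_feasible[OF symmetric] x0(1) cube by blast
  have le: "lin_objective Q c p \<le> ?g x0" if "p \<in> GW_relax_feasible Q" for p
  proof -
    obtain x y where p: "p = (x, y)"
      by (cases p)
    have "x \<in> cbox 0 1"
      using that by (auto simp: p cube GW_relax_feasible_def)
    then show ?thesis
      using lin_objective_le_best_y[OF symmetric, of x y c] that x0(2) p by fastforce
  qed
  have "is_max_value (lin_objective Q c) (GW_relax_feasible Q) (?g x0)"
       "is_max_value (lin_objective Q c) (FT_relax_feasible Q) (?g x0)"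
    using FT le FT_relax_feasible_subset_GW[OF symmetric] by (auto simp: is_max_value_def)
  then show ?thesis
    by blast
qed

end
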